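(* For every $\ell>0$, the magnitude of the ternary Cantor set $T_\ell$ of length $\ell$ is \[|T_\ell| = 1+\frac12\sum_{i=1}^{\infty}2^i\tanh\left(\frac{\ell}{2\cdot 3^i}\right).\]
   Context: A weighting on a finite metric space $(W,d)$ is a choice of real number $w_x$ for each $x\in W$ such that $\sum_{x'\in W} e^{-d(x,x')}w_{x'}=1$ for every $x\in W$. If a weighting exists, the magnitude of $W$ is $|W| := \sum_{x\in W} w_x$; this is independent of the choice of weighting. A metric space $X$ is positive definite if for every finite subspace $W\subseteq X$ the matrix $(e^{-d(x,x')})_{x,x'\in W}$ is positive definite; subspaces of Euclidean space are positive definite, and finite positive definite spaces have a well-defined magnitude. The magnitude of a compact positive definite metric space $X$ is defined as $|X| := \sup\{|W| : W\subseteq X\text{ finite}\}$; equivalently (a result of Meckes), $|X|=\lim_{k}|X_k|$ for any sequence $(X_k)$ of finite subsets of $X$ converging to $X$ in the Hausdorff metric. The ternary Cantor set $T_\ell\subset\mathbb R$ of length $\ell$ is the standard middle-third Cantor set constructed from a closed interval of length $\ell$ (repeatedly removing open middle thirds), with the subspace metric from $\mathbb R$; taking the interval to be $[0,\ell]$, it is the unique non-empty compact set with $T_\ell=\psi_1(T_\ell)\cup\psi_2(T_\ell)$, where $\psi_1(x)=x/3$, $\psi_2(x)=x/3+2\ell/3$. *)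

theory Defs
  imports "HOL-Analysis.Analysis"
begin

definition is_weighting :: "'a::metric_space set \<Rightarrow> ('a \<Rightarrow> real) \<Rightarrow> bool" where
  "is_weighting W w \<longleftrightarrow> (\<forall>x\<in>W. (\<Sum>y\<in>W. exp (- dist x y) * w y) = 1)"

text \<open>
  Only meaningful for finite \<open>W\<close> that admit a weighting; the value then does not depend on
  the weighting chosen, see \<open>finite_magnitude_eq\<close> below.
\<close>
definition finite_magnitude :: "'a::metric_space set \<Rightarrow> real" where
  "finite_magnitude W = (THE m. \<exists>w. is_weighting W w \<and> m = (\<Sum>x\<in>W. w x))"

definition positive_definite_space :: "'a::metric_space set \<Rightarrow> bool" where
  "positive_definite_space X \<longleftrightarrow>
     (\<forall>W v. finite W \<and> W \<subseteq> X \<and> (\<exists>x\<in>W. v x \<noteq> (0::real)) \<longrightarrow>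
        0 < (\<Sum>x\<in>W. \<Sum>y\<in>W. v x * exp (- dist x y) * v y))"

text \<open>
  The magnitude of a compact positive definite space. The supremum is taken in the extended
  reals, so that a finite value includes the claim that the finite magnitudes are bounded.
\<close>
definition magnitude :: "'a::metric_space set \<Rightarrow> ereal" where
  "magnitude X = (SUP W\<in>{W. finite W \<and> W \<subseteq> X}. ereal (finite_magnitude W))"

text \<open>
  \<open>cantor_stage n a b\<close> is what is left of the interval from \<open>a\<close> to \<open>b\<close> after removing open
  middle thirds \<open>n\<close> times.
\<close>
fun cantor_stage :: "nat \<Rightarrow> real \<Rightarrow> real \<Rightarrow> real set" where
  "cantor_stage 0 a b = {a..b}"
| "cantor_stage (Suc n) a b =
     cantor_stage n a (a + (b - a) / 3) \<union> cantor_stage n (b - (b - a) / 3) b"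

definition ternary_cantor_set :: "real \<Rightarrow> real set" where
  "ternary_cantor_set l = (\<Inter>n. cantor_stage n 0 l)"

lemma finite_magnitude_eq:
  assumes "is_weighting W w"
  shows "finite_magnitude W = (\<Sum>x\<in>W. w x)"
proof -
  have "sum u W = sum w W" if u: "is_weighting W u" for u
  proof -
    have "sum u W = (\<Sum>x\<in>W. u x * (\<Sum>y\<in>W. exp (- dist x y) * w y))"
      using assms unfolding is_weighting_def by (intro sum.cong) (simp_all only: mult_1_right)
    also have "\<dots> = (\<Sum>x\<in>W. \<Sum>y\<in>W. u x * (exp (- dist x y) * w y))"
      by (simp add: sum_distrib_left)
    also have "\<dots> = (\<Sum>y\<in>W. \<Sum>x\<in>W. u x * (exp (- dist x y) * w y))"
      by (rule sum.swap)
    also have "\<dots> = (\<Sum>y\<in>W. (\<Sum>x\<in>W. exp (- dist y x) * u x) * w y)"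
      unfolding sum_distrib_right
      by (intro sum.cong) (simp_all only: dist_commute mult.assoc mult.commute [of "exp _" "u _"])
    also have "\<dots> = sum w W"
      using u unfolding is_weighting_def by (intro sum.cong) (simp_all only: mult_1_left)
    finally show ?thesis .
  qed
  then show ?thesis
    unfolding finite_magnitude_def using assms by (intro the_equality) blast+
qed

lemma positive_definite_real_aux:
  fixes v :: "real \<Rightarrow> real"
  assumes "finite W" and "\<forall>x\<in>W. x < t" and "\<exists>x\<in>W. v x \<noteq> 0"
  shows "(exp (- t) * (\<Sum>x\<in>W. v x * exp x))\<^sup>2
           < (\<Sum>x\<in>W. \<Sum>y\<in>W. v x * exp (- dist x y) * v y)"
  using assms
proof (induction W arbitrary: t rule: finite_linorder_max_induct)
  case empty
  then show ?case by simp
next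
  case (insert m A)
  define F where "F = (\<Sum>x\<in>A. v x * exp x)"
  define Q where "Q = (\<Sum>x\<in>A. \<Sum>y\<in>A. v x * exp (- dist x y) * v y)"
  define G where "G = v m + exp (- m) * F"
  have mA: "m \<notin> A" using insert.hyps by auto
  have mt: "m < t" using insert.prems by simp
  have L: "(\<Sum>x\<in>A. v x * exp (- dist x m)) = exp (- m) * F"
    unfolding F_def sum_distrib_left
  proof (rule sum.cong)
    fix x assume "x \<in> A"
    then have "x < m" using insert.hyps by auto
    then have "exp (- dist x m) = exp (- m) * exp x"
      by (simp add: dist_real_def exp_add [symmetric])
    then show "v x * exp (- dist x m) = exp (- m) * (v x * exp x)" by simp
  qed simp
  have F': "(\<Sum>x\<in>insert m A. v x * exp x) = exp m * G"
    using insert.hyps mA by (simp add: F_def G_def algebra_simps exp_minus)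
  have L': "(\<Sum>y\<in>A. v m * exp (- dist m y) * v y) = v m * (exp (- m) * F)"
    unfolding L [symmetric] sum_distrib_left
    by (intro sum.cong) (simp_all add: dist_commute mult_ac)
  have L'': "(\<Sum>x\<in>A. v x * exp (- dist x m) * v m) = v m * (exp (- m) * F)"
    unfolding L [symmetric] sum_distrib_left
    by (intro sum.cong) (simp_all add: mult_ac)
  have "(\<Sum>x\<in>insert m A. \<Sum>y\<in>insert m A. v x * exp (- dist x y) * v y)
      = v m * v m + (\<Sum>y\<in>A. v m * exp (- dist m y) * v y)
        + ((\<Sum>x\<in>A. v x * exp (- dist x m) * v m) + Q)"
    using insert.hyps mA by (simp add: sum.distrib Q_def)
  also have "\<dots> = (Q - (exp (- m) * F)\<^sup>2) + G\<^sup>2"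
    unfolding L' L'' by (simp add: G_def power2_eq_square algebra_simps)
  finally have Q': "(\<Sum>x\<in>insert m A. \<Sum>y\<in>insert m A. v x * exp (- dist x y) * v y)
      = (Q - (exp (- m) * F)\<^sup>2) + G\<^sup>2" .
  have E: "exp (- t) * (exp m * G) = exp (m - t) * G"
    by (simp add: exp_diff exp_minus field_simps)
  have e1: "(exp (m - t))\<^sup>2 < 1"
    using mt by (simp add: power_less_one_iff)
  show ?case
  proof (cases "\<exists>x\<in>A. v x \<noteq> 0")
    case True
    then have "(exp (- m) * F)\<^sup>2 < Q"
      unfolding F_def Q_def using insert.IH insert.hyps by blast
    moreover have "(exp (m - t) * G)\<^sup>2 \<le> G\<^sup>2"
      using e1 by (simp add: power_mult_distrib mult_left_le_one_le)
    ultimately show ?thesis unfolding F' Q' E by linarith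
  next
    case False
    then have "F = 0" "Q = 0" unfolding F_def Q_def by simp_all
    moreover have "v m \<noteq> 0" using False insert.prems by auto
    ultimately have "G \<noteq> 0" by (simp add: G_def)
    then have "(exp (m - t) * G)\<^sup>2 < G\<^sup>2"
      using e1 by (simp add: power_mult_distrib)
    then show ?thesis unfolding F' Q' E using \<open>F = 0\<close> \<open>Q = 0\<close> by simp
  qed
qed

lemma positive_definite_real: "positive_definite_space (X :: real set)"
  unfolding positive_definite_space_def
proof (intro allI impI)
  fix W and v :: "real \<Rightarrow> real"
  assume W: "finite W \<and> W \<subseteq> X \<and> (\<exists>x\<in>W. v x \<noteq> 0)"
  then have "\<forall>x\<in>W. x < Max W + 1"
    by (metis Max_ge le_less_trans less_add_one)
  with W have "(exp (- (Max W + 1)) * (\<Sum>x\<in>W. v x * exp x))\<^sup>2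
      < (\<Sum>x\<in>W. \<Sum>y\<in>W. v x * exp (- dist x y) * v y)"
    by (intro positive_definite_real_aux) simp_all
  then show "0 < (\<Sum>x\<in>W. \<Sum>y\<in>W. v x * exp (- dist x y) * v y)"
    by (rule le_less_trans [OF zero_le_power2])
qed

lemma cantor_stage_affine:
  assumes "c > 0"
  shows "cantor_stage n (c * a + d) (c * b + d) = (\<lambda>x. c * x + d) ` cantor_stage n a b"
proof (induction n arbitrary: a b)
  case 0
  show ?case using assms by (simp add: image_affinity_atLeastAtMost)
next
  case (Suc n)
  have "c * a + d + (c * b + d - (c * a + d)) / 3 = c * (a + (b - a) / 3) + d"
    "c * b + d - (c * b + d - (c * a + d)) / 3 = c * (b - (b - a) / 3) + d"
    by (simp_all add: field_simps)
  then show ?case by (simp only: cantor_stage.simps Suc.IH image_Un)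
qed

lemma cantor_stage_Suc_images:
  "cantor_stage (Suc n) 0 l =
     (\<lambda>x. x / 3) ` cantor_stage n 0 l \<union> (\<lambda>x. x / 3 + 2 * l / 3) ` cantor_stage n 0 l"
  using cantor_stage_affine [of "1/3" n 0 0 l] cantor_stage_affine [of "1/3" n 0 "2*l/3" l]
  by (simp add: field_simps)

lemma cantor_stage_subset: "a \<le> b \<Longrightarrow> cantor_stage n a b \<subseteq> {a..b}"
proof (induction n arbitrary: a b)
  case (Suc n)
  have "cantor_stage n a (a + (b - a) / 3) \<subseteq> {a..a + (b - a) / 3}"
    "cantor_stage n (b - (b - a) / 3) b \<subseteq> {b - (b - a) / 3..b}"
    using Suc.prems by (intro Suc.IH; simp)+
  moreover have "{a..a + (b - a) / 3} \<subseteq> {a..b}" "{b - (b - a) / 3..b} \<subseteq> {a..b}"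
    using Suc.prems by (simp_all add: field_simps)
  ultimately show ?case unfolding cantor_stage.simps by blast
qed simp

lemma compact_cantor_stage: "compact (cantor_stage n a b)"
  by (induction n arbitrary: a b) auto

lemma zero_in_cantor_stage: "0 \<le> l \<Longrightarrow> 0 \<in> cantor_stage n 0 l"
  by (induction n arbitrary: l) auto

lemma compact_ternary_cantor_set: "compact (ternary_cantor_set l)"
  unfolding ternary_cantor_set_def
  by (intro compact_Inter) (auto simp: compact_cantor_stage)

lemma ternary_cantor_set_nonempty: "0 \<le> l \<Longrightarrow> ternary_cantor_set l \<noteq> {}"
  using zero_in_cantor_stage unfolding ternary_cantor_set_def by blast

lemma ternary_cantor_set_self_similar:
  assumes "l > 0"
  shows "ternary_cantor_set l =
    (\<lambda>x. x / 3) ` ternary_cantor_set l \<union> (\<lambda>x. x / 3 + 2 * l / 3) ` ternary_cantor_set l"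
    (is "?C = ?f ` ?C \<union> ?g ` ?C")
proof (intro subset_antisym subsetI)
  fix x assume x: "x \<in> ?C"
  have sub: "cantor_stage n 0 l \<subseteq> {0..l}" for n
    using cantor_stage_subset assms by simp
  have st: "x \<in> ?f ` cantor_stage n 0 l \<union> ?g ` cantor_stage n 0 l" for n
    using x cantor_stage_Suc_images [of n l] unfolding ternary_cantor_set_def by blast
  show "x \<in> ?f ` ?C \<union> ?g ` ?C"
  proof (cases "x \<le> l / 3")
    case True
    have "3 * x \<in> cantor_stage n 0 l" for n
    proof -
      consider z where "z \<in> cantor_stage n 0 l" "x = z / 3"
        | z where "z \<in> cantor_stage n 0 l" "x = z / 3 + 2 * l / 3"
        using st [of n] by blast
      then show ?thesis
      proof cases
        case (1 z)
        then have "3 * x = z" by simp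
        then show ?thesis using 1(1) by simp
      next
        case (2 z)
        then have "0 \<le> z" using sub [of n] by auto
        then show ?thesis using 2(2) True assms by linarith
      qed
    qed
    then have "3 * x \<in> ?C" by (simp add: ternary_cantor_set_def)
    moreover have "x = ?f (3 * x)" by simp
    ultimately have "x \<in> ?f ` ?C" by (rule rev_image_eqI)
    then show ?thesis by (rule UnI1)
  next
    case False
    have "3 * x - 2 * l \<in> cantor_stage n 0 l" for n
    proof -
      consider z where "z \<in> cantor_stage n 0 l" "x = z / 3"
        | z where "z \<in> cantor_stage n 0 l" "x = z / 3 + 2 * l / 3"
        using st [of n] by blast
      then show ?thesis
      proof cases
        case (1 z)
        then have "z \<le> l" using sub [of n] by auto
        then show ?thesis using 1(2) False by linarith
      next
        case (2 z)
        then have "3 * x - 2 * l = z" by simp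
        then show ?thesis using 2(1) by simp
      qed
    qed
    then have "3 * x - 2 * l \<in> ?C" by (simp add: ternary_cantor_set_def)
    moreover have "x = ?g (3 * x - 2 * l)" by (simp add: field_simps)
    ultimately have "x \<in> ?g ` ?C" by (rule rev_image_eqI)
    then show ?thesis by (rule UnI2)
  qed
next
  fix x assume x: "x \<in> ?f ` ?C \<union> ?g ` ?C"
  have "x \<in> cantor_stage n 0 l" for n
  proof (cases n)
    case 0
    have "?C \<subseteq> {0..l}"
      unfolding ternary_cantor_set_def by (metis INF_lower UNIV_I cantor_stage.simps(1))
    then show ?thesis using x assms 0 by (auto simp: subset_iff)
  next
    case (Suc k)
    have "?C \<subseteq> cantor_stage k 0 l" by (auto simp: ternary_cantor_set_def)
    then show ?thesis
      using x unfolding Suc cantor_stage_Suc_images by blast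
  qed
  then show "x \<in> ?C" by (simp add: ternary_cantor_set_def)
qed

lemma ternary_cantor_set_unique:
  assumes "l > 0" and "compact T" and "T \<noteq> {}"
    and T: "T = (\<lambda>x. x / 3) ` T \<union> (\<lambda>x. x / 3 + 2 * l / 3) ` T"
  shows "T = ternary_cantor_set l"
proof -
  obtain M where M: "M \<in> T" "\<forall>x\<in>T. x \<le> M"
    using compact_attains_sup assms(2,3) by blast
  obtain m where m: "m \<in> T" "\<forall>x\<in>T. m \<le> x"
    using compact_attains_inf assms(2,3) by blast
  have "M \<in> (\<lambda>x. x / 3) ` T \<union> (\<lambda>x. x / 3 + 2 * l / 3) ` T" using M T by blast
  then have "M \<le> l" using M(2) \<open>l > 0\<close> by fastforce
  have "m \<in> (\<lambda>x. x / 3) ` T \<union> (\<lambda>x. x / 3 + 2 * l / 3) ` T" using m T by blast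
  then have "0 \<le> m" using m(2) \<open>l > 0\<close> by fastforce
  have T0: "T \<subseteq> {0..l}" using M m \<open>M \<le> l\<close> \<open>0 \<le> m\<close> by fastforce
  have "T \<subseteq> cantor_stage n 0 l" for n
  proof (induction n)
    case (Suc n)
    then show ?case unfolding cantor_stage_Suc_images by (subst T) blast
  qed (use T0 in simp)
  then have sub: "T \<subseteq> ternary_cantor_set l" by (auto simp: ternary_cantor_set_def)
  have near: "\<exists>y\<in>T. \<bar>x - y\<bar> \<le> l / 3 ^ n" if "x \<in> cantor_stage n 0 l" for x n
    using that
  proof (induction n arbitrary: x)
    case 0
    then show ?case using m(1) T0 by (intro bexI [of _ m]) (auto simp: subset_iff abs_le_iff)
  next
    case (Suc n)
    then obtain z c where z: "z \<in> cantor_stage n 0 l" "x = z / 3 + c" "c = 0 \<or> c = 2 * l / 3"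
      unfolding cantor_stage_Suc_images by fastforce
    obtain y where y: "y \<in> T" "\<bar>z - y\<bar> \<le> l / 3 ^ n" using Suc.IH z(1) by blast
    have "y / 3 + c \<in> T"
    proof -
      have "y / 3 + c \<in> (\<lambda>x. x / 3) ` T \<union> (\<lambda>x. x / 3 + 2 * l / 3) ` T"
        using z(3) imageI [OF y(1), of "\<lambda>x. x / 3"]
          imageI [OF y(1), of "\<lambda>x. x / 3 + 2 * l / 3"] by fastforce
      then show ?thesis using T by blast
    qed
    moreover have "x - (y / 3 + c) = (z - y) / 3" using z(2) by simp
    then have "\<bar>x - (y / 3 + c)\<bar> \<le> l / 3 ^ Suc n" using y(2) by simp
    ultimately show ?case by blast
  qed
  have "ternary_cantor_set l \<subseteq> closure T"
  proof
    fix x assume x: "x \<in> ternary_cantor_set l"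
    show "x \<in> closure T"
      unfolding closure_approachable
    proof (intro allI impI)
      fix e :: real assume "0 < e"
      then obtain n where n: "(1/3) ^ n < e / l"
        using real_arch_pow_inv [of "e / l" "1/3"] \<open>l > 0\<close> by auto
      then have "l / 3 ^ n < e" using \<open>l > 0\<close> by (simp add: field_simps power_divide)
      moreover obtain y where "y \<in> T" "\<bar>x - y\<bar> \<le> l / 3 ^ n"
        using near [of x n] x unfolding ternary_cantor_set_def by blast
      ultimately show "\<exists>y\<in>T. dist y x < e"
        by (metis abs_minus_commute dist_real_def le_less_trans)
    qed
  qed
  then show ?thesis using sub assms(2) by (simp add: compact_imp_closed subset_antisym)
qed

end

theory Submission
  imports Defs
begin

text \<open>
  If finite sets \<open>A\<close> and \<open>B\<close> of reals are separated by a gap of length \<open>d\<close>, then a weighting of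
  \<open>A \<union> B\<close> arises from weightings of \<open>A\<close> and \<open>B\<close> by correcting only the two points at the gap,
  and so \<open>|A \<union> B| = |A| + |B| - 1 + tanh (d/2)\<close>. Both halves of the Cantor set being Cantor sets
  of a third of the length, separated by a third, this gives a recursion in the length: it
  computes the magnitude of the set of endpoints of the \<open>n\<close>-th stage, which bounds the
  supremum from below. Magnitude is monotone because of positive definiteness, and
  a finite subset of an interval of length \<open>l\<close> has magnitude at most \<open>1 + l/2\<close> because
  \<open>tanh x \<le> x\<close>; starting the same recursion from this bound yields an upper bound that exceeds
  the \<open>n\<close>-th partial sum by \<open>(2/3)^n l/2\<close>, which tends to \<open>0\<close>.
\<close>

section \<open>A bound on tanh and the monotonicity of magnitude\<close>

text \<open>The difference \<open>x - tanh x\<close> vanishes at 0 and has derivative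
  \<open>tanh x ^ 2\<close>.\<close>

lemma tanh_le_self:
  fixes x :: real
  assumes "0 \<le> x"
  shows "tanh x \<le> x"
proof -
  have "0 - tanh 0 \<le> x - tanh x"
  proof (rule DERIV_nonneg_imp_nondecreasing [OF assms])
    fix y :: real
    have "((\<lambda>x. x - tanh x) has_real_derivative 1 - (1 - tanh y ^ 2)) (at y)"
      by (auto intro!: derivative_eq_intros)
    then show "\<exists>D. ((\<lambda>x. x - tanh x) has_real_derivative D) (at y) \<and> 0 \<le> D"
      by (intro exI conjI) auto
  qed
  then show ?thesis by simp
qed

text \<open>Extend \<open>u\<close> by zero to \<open>v\<close> on \<open>B\<close>. The quadratic
  form of the kernel at \<open>w - v\<close> equals the difference of the two magnitudes, and
  positive definiteness makes it nonnegative.\<close>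

lemma finite_magnitude_mono:
  assumes pd: "positive_definite_space B" and "finite B" and "A \<subseteq> B"
    and u: "is_weighting A u" and w: "is_weighting B w"
  shows "finite_magnitude A \<le> finite_magnitude B"
proof -
  define v where "v x = (if x \<in> A then u x else 0)" for x
  have v_sum: "(\<Sum>y\<in>B. g y * v y) = (\<Sum>y\<in>A. g y * u y)" for g
    unfolding v_def using assms(2,3) by (intro sum.mono_neutral_cong_right) auto
  have Zv: "(\<Sum>y\<in>B. exp (- dist x y) * v y) = 1" if "x \<in> A" for x
    using u that unfolding v_sum is_weighting_def by blast
  have Zw: "(\<Sum>y\<in>B. exp (- dist x y) * w y) = 1" if "x \<in> B" for x
    using w that unfolding is_weighting_def by blast
  have sv: "sum v B = sum u A" using v_sum [of "\<lambda>_. 1"] by simp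
  have vZ: "(\<Sum>x\<in>B. v x * g x) = (\<Sum>x\<in>A. u x * g x)" for g
    using v_sum [of g] by (simp add: mult.commute)
  \<comment> \<open>Outside \<open>A\<close> the kernel sum of \<open>v\<close> is not known; by
    symmetry the kernel moves onto \<open>w\<close>, where it gives 1 on all of
    \<open>B\<close>.\<close>
  have "(\<Sum>x\<in>B. w x * (\<Sum>y\<in>B. exp (- dist x y) * v y))
      = (\<Sum>y\<in>B. v y * (\<Sum>x\<in>B. exp (- dist y x) * w x))"
    unfolding sum_distrib_left by (subst sum.swap) (simp add: dist_commute mult_ac)
  also have "\<dots> = sum v B" by (intro sum.cong) (simp_all add: Zw)
  finally have wZv: "(\<Sum>x\<in>B. w x * (\<Sum>y\<in>B. exp (- dist x y) * v y)) = sum u A"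
    using sv by simp
  have vZv: "(\<Sum>x\<in>B. v x * (\<Sum>y\<in>B. exp (- dist x y) * v y)) = sum u A"
    unfolding vZ by (intro sum.cong) (simp_all add: Zv)
  have "0 \<le> (\<Sum>x\<in>B. \<Sum>y\<in>B. (w x - v x) * exp (- dist x y) * (w y - v y))"
  proof (cases "\<exists>x\<in>B. w x - v x \<noteq> 0")
    case True
    then show ?thesis
      using pd [unfolded positive_definite_space_def, rule_format, of B "\<lambda>x. w x - v x"]
        \<open>finite B\<close>
      by simp
  qed simp
  also have "\<dots> = (\<Sum>x\<in>B. (w x - v x) * ((\<Sum>y\<in>B. exp (- dist x y) * w y)
      - (\<Sum>y\<in>B. exp (- dist x y) * v y)))"
    unfolding sum_subtractf [symmetric] right_diff_distrib [symmetric] sum_distrib_left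
      mult.assoc ..
  also have "\<dots> = (\<Sum>x\<in>B. (w x - v x) * (1 - (\<Sum>y\<in>B. exp (- dist x y) * v y)))"
    by (intro sum.cong) (simp_all add: Zw)
  also have "\<dots> = sum w B - sum v B - (\<Sum>x\<in>B. w x * (\<Sum>y\<in>B. exp (- dist x y) * v y))
      + (\<Sum>x\<in>B. v x * (\<Sum>y\<in>B. exp (- dist x y) * v y))"
    by (simp add: left_diff_distrib right_diff_distrib sum_subtractf)
  also have "\<dots> = sum w B - sum u A" unfolding wZv vZv sv by simp
  finally show ?thesis
    using finite_magnitude_eq [OF u] finite_magnitude_eq [OF w] by simp
qed

section \<open>Finite subsets of the line\<close>

text \<open>Distances across the gap pass through \<open>p\<close> and \<open>q\<close>, so for
  \<open>x\<close> in \<open>A\<close> the kernel sum of \<open>v\<close> over \<open>B\<close> is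
  just \<open>exp (- dist x q)\<close>, a fixed multiple of \<open>exp (- dist x p)\<close>. Hence
  one correction at \<open>p\<close> and \<open>q\<close> removes this excess for all such
  \<open>x\<close> at once, and likewise for \<open>x\<close> in \<open>B\<close>.\<close>

lemma weighting_union:
  fixes A B :: "real set"
  assumes fin: "finite A" "finite B"
    and p: "p \<in> A" "\<forall>a\<in>A. a \<le> p" and q: "q \<in> B" "\<forall>b\<in>B. q \<le> b" and "p < q"
    and u: "is_weighting A u" and v: "is_weighting B v"
  obtains w where "is_weighting (A \<union> B) w"
    "sum w (A \<union> B) = sum u A + sum v B - 1 + tanh ((q - p) / 2)"
proof -
  define e where "e = exp (- (q - p))"
  \<comment> \<open>For \<open>x\<close> in \<open>A\<close> and \<open>t = exp (- dist x p)\<close>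
    the excess is \<open>e * t\<close>, and the corrections add \<open>c * t + c * e * t\<close>;
    this \<open>c\<close> makes them cancel.\<close>
  define c where "c = - e / (1 + e)"
  have e: "e > 0" by (simp add: e_def)
  then have c: "e + c + e * c = 0" by (simp add: c_def field_simps)
  define w where "w x = (if x \<in> A then u x else v x) + (if x = p \<or> x = q then c else 0)" for x
  have disj: "A \<inter> B = {}" using p q \<open>p < q\<close> by fastforce
  have pB: "p \<notin> B" and qA: "q \<notin> A" using p(1) q(1) disj by auto
  have sA: "(\<Sum>x\<in>A. g x * w x) = (\<Sum>x\<in>A. g x * u x) + g p * c" for g
  proof -
    have "(\<Sum>x\<in>A. g x * w x) = (\<Sum>x\<in>A. g x * u x + (if x = p then g p * c else 0))"
      unfolding w_def using qA by (intro sum.cong) (auto simp: algebra_simps)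
    then show ?thesis using fin p(1) by (simp add: sum.distrib)
  qed
  have sB: "(\<Sum>x\<in>B. g x * w x) = (\<Sum>x\<in>B. g x * v x) + g q * c" for g
  proof -
    have "(\<Sum>x\<in>B. g x * w x) = (\<Sum>x\<in>B. g x * v x + (if x = q then g q * c else 0))"
      unfolding w_def using pB disj by (intro sum.cong) (auto simp: algebra_simps)
    then show ?thesis using fin q(1) by (simp add: sum.distrib)
  qed
  have s: "(\<Sum>x\<in>A \<union> B. g x * w x)
      = (\<Sum>x\<in>A. g x * u x) + (\<Sum>x\<in>B. g x * v x) + (g p + g q) * c" for g
    using fin disj by (simp add: sum.union_disjoint sA sB algebra_simps)
  have uA: "(\<Sum>y\<in>A. exp (- dist x y) * u y) = 1" if "x \<in> A" for x
    using u that unfolding is_weighting_def by blast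
  have vB: "(\<Sum>y\<in>B. exp (- dist x y) * v y) = 1" if "x \<in> B" for x
    using v that unfolding is_weighting_def by blast
  have "is_weighting (A \<union> B) w"
    unfolding is_weighting_def s
  proof
    fix x assume "x \<in> A \<union> B"
    then consider "x \<in> A" | "x \<in> B" by blast
    then show "(\<Sum>y\<in>A. exp (- dist x y) * u y) + (\<Sum>y\<in>B. exp (- dist x y) * v y)
        + (exp (- dist x p) + exp (- dist x q)) * c = 1"
    proof cases
      case 1
      then have x: "x \<le> p" using p by blast
      have xq: "exp (- dist x q) = exp (- dist x p) * e"
        using x \<open>p < q\<close> by (simp add: e_def dist_real_def exp_add [symmetric])
      have "(\<Sum>y\<in>B. exp (- dist x y) * v y)
          = (\<Sum>y\<in>B. exp (- dist x q) * (exp (- dist q y) * v y))"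
      proof (rule sum.cong)
        fix y assume "y \<in> B"
        then have "q \<le> y" using q by blast
        then have "exp (- dist x y) = exp (- dist x q) * exp (- dist q y)"
          using x \<open>p < q\<close> by (simp add: dist_real_def exp_add [symmetric])
        then show "exp (- dist x y) * v y = exp (- dist x q) * (exp (- dist q y) * v y)"
          by simp
      qed simp
      also have "\<dots> = exp (- dist x p) * e"
        unfolding sum_distrib_left [symmetric] vB [OF q(1)] xq by simp
      finally show ?thesis
        using uA [OF 1] c xq by algebra
    next
      case 2
      then have x: "q \<le> x" using q by blast
      have xp: "exp (- dist x p) = exp (- dist x q) * e"
        using x \<open>p < q\<close> by (simp add: e_def dist_real_def exp_add [symmetric])
      have "(\<Sum>y\<in>A. exp (- dist x y) * u y)
          = (\<Sum>y\<in>A. exp (- dist x p) * (exp (- dist p y) * u y))"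
      proof (rule sum.cong)
        fix y assume "y \<in> A"
        then have "y \<le> p" using p by blast
        then have "exp (- dist x y) = exp (- dist x p) * exp (- dist p y)"
          using x \<open>p < q\<close> by (simp add: dist_real_def exp_add [symmetric])
        then show "exp (- dist x y) * u y = exp (- dist x p) * (exp (- dist p y) * u y)"
          by simp
      qed simp
      also have "\<dots> = exp (- dist x q) * e"
        unfolding sum_distrib_left [symmetric] uA [OF p(1)] xp by simp
      finally show ?thesis
        using vB [OF 2] c xp by algebra
    qed
  qed
  moreover have "sum w (A \<union> B) = sum u A + sum v B - 1 + tanh ((q - p) / 2)"
  proof -
    have "tanh ((q - p) / 2) = (1 - e) / (1 + e)"
      by (simp add: tanh_real_altdef e_def diff_divide_distrib)
    \<comment> \<open>The corrections at \<open>p\<close> and \<open>q\<close> change the total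
      weight by \<open>2 * c\<close>.\<close>
    also have "\<dots> = 1 + 2 * c" using e by (simp add: c_def field_simps)
    finally show ?thesis using s [of "\<lambda>_. 1"] by simp
  qed
  ultimately show ?thesis by (rule that)
qed

lemma is_weighting_singleton: "is_weighting {x} (\<lambda>_. 1)"
  by (simp add: is_weighting_def)

lemma finite_magnitude_empty: "finite_magnitude {} = 0"
  using finite_magnitude_eq [of "{}" "\<lambda>_. 0"] by (simp add: is_weighting_def)

lemma finite_magnitude_singleton: "finite_magnitude {x} = 1"
  using finite_magnitude_eq [OF is_weighting_singleton] by simp

text \<open>Ensures that the \<open>THE\<close> in \<open>finite_magnitude\<close> denotes for every
  finite set of reals.\<close>

lemma weighting_exists_real:
  fixes W :: "real set"
  assumes "finite W"
  shows "\<exists>w. is_weighting W w"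
  using assms
proof (induction W rule: finite_linorder_max_induct)
  case empty
  show ?case by (simp add: is_weighting_def)
next
  case (insert m A)
  then obtain u where u: "is_weighting A u" by blast
  show ?case
  proof (cases "A = {}")
    case True
    then show ?thesis using is_weighting_singleton by blast
  next
    case False
    then obtain w where "is_weighting (A \<union> {m}) w"
      using insert.hyps
        weighting_union [of A "{m}" "Max A" m, OF _ _ _ _ _ _ _ u is_weighting_singleton]
      by auto
    then show ?thesis by auto
  qed
qed

lemma finite_magnitude_union:
  fixes A B :: "real set"
  assumes "finite A" "finite B"
    and "p \<in> A" "\<forall>a\<in>A. a \<le> p" and "q \<in> B" "\<forall>b\<in>B. q \<le> b" and "p < q"
  shows "finite_magnitude (A \<union> B) =
    finite_magnitude A + finite_magnitude B - 1 + tanh ((q - p) / 2)"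
proof -
  obtain u v where u: "is_weighting A u" and v: "is_weighting B v"
    using weighting_exists_real assms(1,2) by metis
  obtain w where "is_weighting (A \<union> B) w"
    "sum w (A \<union> B) = sum u A + sum v B - 1 + tanh ((q - p) / 2)"
    using weighting_union [OF assms u v] .
  then show ?thesis using u v by (simp add: finite_magnitude_eq)
qed

lemma finite_magnitude_mono_real:
  fixes A B :: "real set"
  assumes "finite B" "A \<subseteq> B"
  shows "finite_magnitude A \<le> finite_magnitude B"
proof -
  obtain u w where "is_weighting A u" "is_weighting B w"
    using weighting_exists_real assms finite_subset by metis
  then show ?thesis
    using finite_magnitude_mono [OF positive_definite_real assms] by blast
qed

text \<open>With the points added from left to right, each gap contributes tanh of half its length,
  hence at most half its length, and the gaps add up to at most \<open>b - a\<close>.\<close>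

lemma finite_magnitude_le_interval:
  fixes W :: "real set"
  assumes "finite W" "W \<subseteq> {a..b}" "a \<le> b"
  shows "finite_magnitude W \<le> 1 + (b - a) / 2"
  using assms
proof (induction W arbitrary: b rule: finite_linorder_max_induct)
  case empty
  then show ?case by (simp add: finite_magnitude_empty)
next
  case (insert m A)
  show ?case
  proof (cases "A = {}")
    case True
    then show ?thesis using insert.prems by (simp add: finite_magnitude_singleton)
  next
    case False
    define p where "p = Max A"
    have p: "p \<in> A" "\<forall>x\<in>A. x \<le> p" "p < m"
      using False insert.hyps by (auto simp: p_def)
    \<comment> \<open>The interval for \<open>A\<close> ends at \<open>p\<close>, which leaves room
      for the gap from \<open>p\<close> to \<open>m\<close>.\<close>
    then have "A \<subseteq> {a..p}" "a \<le> p" using insert.prems by auto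
    then have "finite_magnitude A \<le> 1 + (p - a) / 2" by (rule insert.IH)
    moreover have "finite_magnitude (A \<union> {m}) =
        finite_magnitude A + finite_magnitude {m} - 1 + tanh ((m - p) / 2)"
      using p insert.hyps by (intro finite_magnitude_union) auto
    moreover have "tanh ((m - p) / 2) \<le> (m - p) / 2" using p(3) by (intro tanh_le_self) simp
    ultimately have "finite_magnitude (insert m A) \<le> 1 + (m - a) / 2"
      by (simp add: finite_magnitude_singleton field_simps)
    then show ?thesis using insert.prems(1) by (simp add: field_simps)
  qed
qed

section \<open>The stages of the Cantor set\<close>

text \<open>Step \<open>i\<close>, counted from 0, removes \<open>2 ^ i\<close> gaps of length
  \<open>l / 3 ^ Suc i\<close>, and each contributes tanh of half its length. The series of the
  theorem has \<open>2 ^ Suc i\<close> instead, whence its factor 1/2.\<close>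

definition cantor_partial_sum :: "nat \<Rightarrow> real \<Rightarrow> real" where
  "cantor_partial_sum n l = (\<Sum>i<n. 2 ^ i * tanh (l / (2 * 3 ^ Suc i)))"

lemma cantor_partial_sum_Suc:
  "cantor_partial_sum (Suc n) l = tanh (l / 6) + 2 * cantor_partial_sum n (l / 3)"
  unfolding cantor_partial_sum_def sum.lessThan_Suc_shift
  by (simp add: sum_distrib_left mult_ac)

lemma endpoints_in_cantor_stage:
  assumes "a \<le> b"
  shows "a \<in> cantor_stage n a b" "b \<in> cantor_stage n a b"
  using assms by (induction n arbitrary: a b) auto

text \<open>The second term is half the total length of the \<open>2 ^ n\<close> intervals of the
  stage: inside each the interval bound applies, while the removed gaps enter with their exact
  contribution.\<close>

lemma finite_magnitude_le_cantor_stage: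
  assumes "finite W" "W \<subseteq> cantor_stage n a b" "a < b"
  shows "finite_magnitude W \<le> 1 + (2/3) ^ n * ((b - a) / 2) + cantor_partial_sum n (b - a)"
  using assms
proof (induction n arbitrary: W a b)
  case 0
  then show ?case using finite_magnitude_le_interval [of W a b]
    by (simp add: cantor_partial_sum_def)
next
  case (Suc n)
  define c d where "c = a + (b - a) / 3" and "d = b - (b - a) / 3"
  have ord: "a < c" "c < d" "d < b" using Suc.prems by (simp_all add: c_def d_def field_simps)
  have len: "c - a = (b - a) / 3" "b - d = (b - a) / 3" "d - c = (b - a) / 3"
    by (simp_all add: c_def d_def field_simps)
  \<comment> \<open>\<open>W\<close> may miss the ends \<open>c\<close> and \<open>d\<close> of the
    middle gap, or even a whole half. Adding both points can only increase the magnitude and makes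
    the gap between the halves exactly a third.\<close>
  define A B where "A = insert c (W \<inter> cantor_stage n a c)"
    and "B = insert d (W \<inter> cantor_stage n d b)"
  have A: "finite A" "A \<subseteq> cantor_stage n a c" and B: "finite B" "B \<subseteq> cantor_stage n d b"
    using Suc.prems endpoints_in_cantor_stage ord by (auto simp: A_def B_def)
  have bounds: "A \<subseteq> {a..c}" "B \<subseteq> {d..b}"
    using A B cantor_stage_subset ord by (meson less_imp_le order_trans)+
  have "W \<subseteq> A \<union> B" using Suc.prems(2) by (auto simp: A_def B_def c_def d_def)
  then have "finite_magnitude W \<le> finite_magnitude (A \<union> B)"
    using A B by (intro finite_magnitude_mono_real) auto
  also have "\<dots> = finite_magnitude A + finite_magnitude B - 1 + tanh ((d - c) / 2)"
    using A B bounds ord by (intro finite_magnitude_union) (auto simp: A_def B_def)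
  also have "\<dots> \<le> 1 + (2/3) ^ Suc n * ((b - a) / 2) + cantor_partial_sum (Suc n) (b - a)"
    using Suc.IH [OF A ord(1)] Suc.IH [OF B ord(3)]
    unfolding len cantor_partial_sum_Suc by (simp add: field_simps)
  finally show ?case .
qed

section \<open>Endpoints of the stages\<close>

fun cantor_endpoints :: "nat \<Rightarrow> real \<Rightarrow> real \<Rightarrow> real set" where
  "cantor_endpoints 0 a b = {a, b}"
| "cantor_endpoints (Suc n) a b =
     cantor_endpoints n a (a + (b - a) / 3) \<union> cantor_endpoints n (b - (b - a) / 3) b"

lemma finite_cantor_endpoints: "finite (cantor_endpoints n a b)"
  by (induction n arbitrary: a b) auto

lemma endpoints_in_cantor_endpoints: "a \<in> cantor_endpoints n a b" "b \<in> cantor_endpoints n a b"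
  by (induction n arbitrary: a b) auto

text \<open>The stage \<open>m\<close> is independent of \<open>n\<close>: endpoints are never
  removed, so they lie in the Cantor set itself.\<close>

lemma cantor_endpoints_subset_stage:
  assumes "a \<le> b"
  shows "cantor_endpoints n a b \<subseteq> cantor_stage m a b"
  using assms
proof (induction n arbitrary: m a b)
  case 0
  then show ?case using endpoints_in_cantor_stage by simp
next
  case (Suc n)
  define c d where "c = a + (b - a) / 3" and "d = b - (b - a) / 3"
  have ord: "a \<le> c" "c \<le> d" "d \<le> b" using Suc.prems by (simp_all add: c_def d_def field_simps)
  have *: "cantor_endpoints n a c \<subseteq> cantor_stage k a c"
    "cantor_endpoints n d b \<subseteq> cantor_stage k d b" for k
    using Suc.IH ord by blast+
  show ?case
  proof (cases m)
    case 0
    then show ?thesis using * [of 0] ord by (fastforce simp flip: c_def d_def)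
  next
    case (Suc k)
    then show ?thesis using * [of k] by (auto simp flip: c_def d_def)
  qed
qed

text \<open>Neighbouring endpoints bound either one of the \<open>2 ^ n\<close> intervals left, of
  length \<open>(b - a) / 3 ^ n\<close>, or a removed gap; these two kinds give the last two
  terms.\<close>

lemma finite_magnitude_cantor_endpoints:
  assumes "a < b"
  shows "finite_magnitude (cantor_endpoints n a b) =
    1 + 2 ^ n * tanh ((b - a) / (2 * 3 ^ n)) + cantor_partial_sum n (b - a)"
  using assms
proof (induction n arbitrary: a b)
  case 0
  have "finite_magnitude ({a} \<union> {b}) =
      finite_magnitude {a} + finite_magnitude {b} - 1 + tanh ((b - a) / 2)"
    using 0 by (intro finite_magnitude_union) auto
  then show ?case by (simp add: finite_magnitude_singleton cantor_partial_sum_def insert_commute)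
next
  case (Suc n)
  define c d where "c = a + (b - a) / 3" and "d = b - (b - a) / 3"
  have ord: "a < c" "c < d" "d < b" using Suc.prems by (simp_all add: c_def d_def field_simps)
  have len: "c - a = (b - a) / 3" "b - d = (b - a) / 3" "d - c = (b - a) / 3"
    by (simp_all add: c_def d_def field_simps)
  have bounds: "cantor_endpoints n a c \<subseteq> {a..c}" "cantor_endpoints n d b \<subseteq> {d..b}"
    using cantor_endpoints_subset_stage [of _ _ n 0] ord by simp_all
  have "finite_magnitude (cantor_endpoints n a c \<union> cantor_endpoints n d b) =
      finite_magnitude (cantor_endpoints n a c) + finite_magnitude (cantor_endpoints n d b)
      - 1 + tanh ((d - c) / 2)"
    using bounds ord
    by (intro finite_magnitude_union)
      (auto simp: finite_cantor_endpoints endpoints_in_cantor_endpoints)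
  also have "\<dots> = 1 + 2 ^ Suc n * tanh ((b - a) / (2 * 3 ^ Suc n))
      + cantor_partial_sum (Suc n) (b - a)"
    unfolding Suc.IH [OF ord(1)] Suc.IH [OF ord(3)] len cantor_partial_sum_Suc
    by (simp add: mult_ac)
  finally show ?case by (simp flip: c_def d_def)
qed

section \<open>The magnitude as the common limit of both bounds\<close>

theorem theorem10:
  fixes l :: real
  assumes "l > 0"
  shows "summable (\<lambda>i. 2 ^ Suc i * tanh (l / (2 * 3 ^ Suc i))) \<and>
         magnitude (ternary_cantor_set l) =
           ereal (1 + 1 / 2 * (\<Sum>i. 2 ^ Suc i * tanh (l / (2 * 3 ^ Suc i))))"
proof
  define f where "f = (\<lambda>i. 2 ^ Suc i * tanh (l / (2 * 3 ^ Suc i)))"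
  have summable: "summable f"
  proof (rule summable_comparison_test')
    show "summable (\<lambda>i. l / 3 * (2/3) ^ i)"
      by (intro summable_mult summable_geometric) simp
    fix i :: nat
    have "2 ^ Suc i * tanh (l / (2 * 3 ^ Suc i)) \<le> 2 ^ Suc i * (l / (2 * 3 ^ Suc i))"
      using assms by (intro mult_left_mono tanh_le_self) auto
    also have "\<dots> = l / 3 * (2/3) ^ i" by (simp add: power_divide field_simps)
    finally show "norm (f i) \<le> l / 3 * (2/3) ^ i" using assms by (simp add: f_def)
  qed
  then show "summable (\<lambda>i. 2 ^ Suc i * tanh (l / (2 * 3 ^ Suc i)))"
    unfolding f_def .
  have partial: "cantor_partial_sum n l = 1 / 2 * (\<Sum>i<n. f i)" for n
    unfolding cantor_partial_sum_def f_def sum_distrib_left by simp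
  have lim: "(\<lambda>n. \<Sum>i<n. f i) \<longlonglongrightarrow> suminf f"
    using summable by (rule summable_LIMSEQ)
  have "magnitude (ternary_cantor_set l) = ereal (1 + 1 / 2 * suminf f)"
    unfolding magnitude_def
  proof (rule antisym)
    show "(SUP W\<in>{W. finite W \<and> W \<subseteq> ternary_cantor_set l}. ereal (finite_magnitude W))
        \<le> ereal (1 + 1 / 2 * suminf f)"
    proof (rule SUP_least)
      fix W assume W: "W \<in> {W. finite W \<and> W \<subseteq> ternary_cantor_set l}"
      have le: "finite_magnitude W \<le> 1 + (2/3) ^ n * (l / 2) + 1 / 2 * (\<Sum>i<n. f i)" for n
      proof -
        have "W \<subseteq> cantor_stage n 0 l" using W by (auto simp: ternary_cantor_set_def)
        then show ?thesis
          using finite_magnitude_le_cantor_stage [of W n 0 l] W assms by (simp add: partial)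
      qed
      \<comment> \<open>The surplus \<open>(2/3) ^ n * (l / 2)\<close> vanishes in the limit, while
        the left side does not depend on \<open>n\<close>.\<close>
      have "(\<lambda>n. 1 + (2/3) ^ n * (l / 2) + 1 / 2 * (\<Sum>i<n. f i))
          \<longlonglongrightarrow> 1 + 0 * (l / 2) + 1 / 2 * suminf f"
        by (intro tendsto_intros lim LIMSEQ_realpow_zero) auto
      then have "finite_magnitude W \<le> 1 + 0 * (l / 2) + 1 / 2 * suminf f"
        by (rule LIMSEQ_le_const) (use le in blast)
      then show "ereal (finite_magnitude W) \<le> ereal (1 + 1 / 2 * suminf f)" by simp
    qed
    have "(\<lambda>n. ereal (1 + 1 / 2 * (\<Sum>i<n. f i))) \<longlonglongrightarrow> ereal (1 + 1 / 2 * suminf f)"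
      by (intro tendsto_intros lim)
    then show "ereal (1 + 1 / 2 * suminf f)
        \<le> (SUP W\<in>{W. finite W \<and> W \<subseteq> ternary_cantor_set l}. ereal (finite_magnitude W))"
    proof (rule LIMSEQ_le_const2, intro exI allI impI)
      fix n :: nat
      have "cantor_endpoints n 0 l \<in> {W. finite W \<and> W \<subseteq> ternary_cantor_set l}"
        using assms cantor_endpoints_subset_stage [of 0 l n]
        by (auto simp: finite_cantor_endpoints ternary_cantor_set_def)
      \<comment> \<open>The exact magnitude is larger by
        \<open>2 ^ n * tanh (l / (2 * 3 ^ n))\<close>, which is nonnegative and is dropped.\<close>
      moreover have "1 + 1 / 2 * (\<Sum>i<n. f i) \<le> finite_magnitude (cantor_endpoints n 0 l)"
        using assms by (simp add: finite_magnitude_cantor_endpoints partial)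
      ultimately show "ereal (1 + 1 / 2 * (\<Sum>i<n. f i))
          \<le> (SUP W\<in>{W. finite W \<and> W \<subseteq> ternary_cantor_set l}. ereal (finite_magnitude W))"
        by (intro SUP_upper2 [of "cantor_endpoints n 0 l"]) simp_all
    qed
  qed
  then show "magnitude (ternary_cantor_set l) =
      ereal (1 + 1 / 2 * (\<Sum>i. 2 ^ Suc i * tanh (l / (2 * 3 ^ Suc i))))"
    unfolding f_def .
qed

end
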